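(* Let $w_1,w_2,w_3$ be any odd positive integers, let $y_1\in\mathbb{Z}_p$, and let $n\ge 0$ be an integer. Then \begin{align*} &(w_1w_2)^n\sum_{a=0}^{w_1d-1}\sum_{b=0}^{w_2d-1}(-1)^{a+b}\chi(ab)\xi^{w_3(aw_2+bw_1)}E_{n,\chi,\xi^{w_1w_2}}\Big(w_3y_1+\frac{w_3}{w_1}a+\frac{w_3}{w_2}b\Big)\\ =&(w_2w_3)^n\sum_{a=0}^{w_2d-1}\sum_{b=0}^{w_3d-1}(-1)^{a+b}\chi(ab)\xi^{w_1(aw_3+bw_2)}E_{n,\chi,\xi^{w_2w_3}}\Big(w_1y_1+\frac{w_1}{w_2}a+\frac{w_1}{w_3}b\Big)\\ =&(w_3w_1)^n\sum_{a=0}^{w_3d-1}\sum_{b=0}^{w_1d-1}(-1)^{a+b}\chi(ab)\xi^{w_2(aw_1+bw_3)}E_{n,\chi,\xi^{w_1w_3}}\Big(w_2y_1+\frac{w_2}{w_3}a+\frac{w_2}{w_1}b\Big). \end{align*}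
   Context: Let $p$ be a fixed odd prime, $\mathbb{Z}_p$ the $p$-adic integers, $\mathbb{C}_p$ the completion of an algebraic closure of $\mathbb{Q}_p$. Let $\xi\in\mathbb{C}_p$ be a fixed ramified root of unity, i.e. $\xi^{p^s}=1$ for some positive integer $s$. Let $d$ be a fixed odd positive integer and $\chi$ a primitive Dirichlet character of conductor $d$, regarded as a function on the integers (periodic mod $d$, zero on integers not coprime to $d$) with values in $\mathbb{C}_p$ via a fixed embedding $\overline{\mathbb{Q}}\to\mathbb{C}_p$. For a ramified root of unity $\zeta$ (e.g. $\zeta=\xi^{w}$), the generalized twisted Euler polynomials $E_{n,\chi,\zeta}(x)$ are the polynomials in $x$ (evaluated at arbitrary $x\in\mathbb{C}_p$) defined by $$\frac{2e^{xt}}{\zeta^d e^{dt}+1}\sum_{a=0}^{d-1}(-1)^a\chi(a)\zeta^a e^{at}=\sum_{n=0}^{\infty}E_{n,\chi,\zeta}(x)\frac{t^n}{n!}.$$ *)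

theory Defs
  imports
    "HOL-Analysis.Analysis"
    "HOL-Computational_Algebra.Computational_Algebra"
    "HOL-Number_Theory.Cong"
begin

section \<open>The field of complex p-adic numbers\<close>

text \<open>
  A type cannot depend on the prime $p$, so $C_p$ is not built as a type. Instead, the locales below
  say of a field type with a real-valued absolute value that it is a completion of an algebraic
  closure of $Q_p$. Such a field is unique up to isometric isomorphism.
\<close>

locale ultrametric_field =
  fixes nrm :: "'a :: field_char_0 \<Rightarrow> real"
  assumes nrm_nonneg: "nrm x \<ge> 0"
    and nrm_eq_0_iff: "nrm x = 0 \<longleftrightarrow> x = 0"
    and nrm_mult: "nrm (x * y) = nrm x * nrm y"
    and nrm_ultra: "nrm (x + y) \<le> max (nrm x) (nrm y)"
begin

lemma nrm_1: "nrm 1 = 1"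
  using nrm_mult[of 1 1] nrm_eq_0_iff[of 1] by simp

lemma nrm_minus: "nrm (- x) = nrm x"
proof -
  have "nrm (- 1) * nrm (- 1) = 1"
    using nrm_mult[of "- 1" "- 1"] nrm_1 by simp
  hence "nrm (- 1) = 1"
    using nrm_nonneg[of "- 1"] by (metis abs_of_nonneg abs_square_eq_1 power2_eq_square)
  thus ?thesis
    using nrm_mult[of "- 1" x] by simp
qed

definition ndist :: "'a \<Rightarrow> 'a \<Rightarrow> real" where
  "ndist x y = nrm (x - y)"

sublocale ms: Metric_space UNIV ndist
proof
  show "0 \<le> ndist x y" for x y
    by (simp add: ndist_def nrm_nonneg)
  show "ndist x y = ndist y x" for x y
    using nrm_minus[of "x - y"] by (simp add: ndist_def)
  show "ndist x y = 0 \<longleftrightarrow> x = y" for x y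
    by (simp add: ndist_def nrm_eq_0_iff)
  show "ndist x z \<le> ndist x y + ndist y z" for x y z
    using nrm_ultra[of "x - y" "y - z"] nrm_nonneg[of "x - y"] nrm_nonneg[of "y - z"]
    by (simp add: ndist_def)
qed

text \<open>
  In a complete field, the topological closure of the rational numbers is the completion of the
  rationals; when the absolute value is $p$-adic, this is $Q_p$, and its unit ball is $Z_p$.
\<close>

definition Qp :: "'a set" where
  "Qp = ms.mtopology closure_of \<rat>"

definition Zp :: "'a set" where
  "Zp = {x \<in> Qp. nrm x \<le> 1}"

definition Qp_bar :: "'a set" where
  "Qp_bar = {x. \<exists>P. P \<noteq> 0 \<and> (\<forall>i. coeff P i \<in> Qp) \<and> poly P x = 0}"

end

text \<open>
  For an ultrametric absolute value, \<open>nrm p = 1 / p\<close> already determines it on the rationals: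
  if $q$ is coprime to $p$, then $1 = u p + v q$ for integers $u$, $v$, which forces \<open>nrm q = 1\<close>.
\<close>

locale complex_padic_field = ultrametric_field nrm
  for nrm :: "'a :: field_char_0 \<Rightarrow> real" +
  fixes p :: nat
  assumes prime_p: "prime p"
    and nrm_p: "nrm (of_nat p) = 1 / real p"
    and Qp_bar_alg_closed:
      "\<lbrakk>degree P > 0; \<And>i. coeff P i \<in> Qp_bar\<rbrakk> \<Longrightarrow> \<exists>x\<in>Qp_bar. poly P x = 0"
    and complete: "ms.mcomplete"
    and Qp_bar_dense: "ms.mtopology closure_of Qp_bar = UNIV"


section \<open>Dirichlet characters\<close>

definition dirichlet_character :: "nat \<Rightarrow> (int \<Rightarrow> 'a :: field) \<Rightarrow> bool" where
  "dirichlet_character d chi \<longleftrightarrow>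
     d > 0 \<and>
     (\<forall>a. chi (a + int d) = chi a) \<and>
     (\<forall>a b. chi (a * b) = chi a * chi b) \<and>
     (\<forall>a. chi a \<noteq> 0 \<longleftrightarrow> coprime a (int d))"

definition character_conductor :: "nat \<Rightarrow> (int \<Rightarrow> 'a :: field) \<Rightarrow> nat" where
  "character_conductor d chi =
     (LEAST e. e dvd d \<and>
        (\<forall>a b. coprime a (int d) \<longrightarrow> coprime b (int d) \<longrightarrow> [a = b] (mod int e) \<longrightarrow> chi a = chi b))"

definition primitive_dirichlet_character :: "nat \<Rightarrow> (int \<Rightarrow> 'a :: field) \<Rightarrow> bool" where
  "primitive_dirichlet_character d chi \<longleftrightarrow>
     dirichlet_character d chi \<and> character_conductor d chi = d"

text \<open>
  Embeddings of the field of algebraic numbers, realised inside the complex numbers; the values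
  outside the algebraic numbers are irrelevant. Injectivity is automatic for a ring homomorphism
  between fields.
\<close>

definition algebraic_numbers_embedding :: "(complex \<Rightarrow> 'a :: field) \<Rightarrow> bool" where
  "algebraic_numbers_embedding \<iota> \<longleftrightarrow>
     \<iota> 1 = 1 \<and>
     (\<forall>x y. algebraic x \<longrightarrow> algebraic y \<longrightarrow>
        \<iota> (x + y) = \<iota> x + \<iota> y \<and> \<iota> (x * y) = \<iota> x * \<iota> y)"


section \<open>Generalized twisted Euler polynomials\<close>

text \<open>
  The generating function in the variable $t$, as a formal power series. The quotient is meaningful
  as soon as $\zeta^d \neq -1$, which holds for odd $d$ and $\zeta$ a root of unity of odd order.
\<close>

definition twisted_euler_gf ::
  "nat \<Rightarrow> (int \<Rightarrow> 'a) \<Rightarrow> 'a \<Rightarrow> 'a \<Rightarrow> 'a :: field_char_0 fps" where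
  "twisted_euler_gf d chi \<zeta> x =
     2 * fps_exp x / (fps_const (\<zeta> ^ d) * fps_exp (of_nat d) + 1) *
     (\<Sum>a<d. fps_const ((- 1) ^ a * chi (int a) * \<zeta> ^ a) * fps_exp (of_nat a))"

definition twisted_euler ::
  "nat \<Rightarrow> nat \<Rightarrow> (int \<Rightarrow> 'a) \<Rightarrow> 'a \<Rightarrow> 'a \<Rightarrow> 'a :: field_char_0" where
  "twisted_euler n d chi \<zeta> x = fact n * fps_nth (twisted_euler_gf d chi \<zeta> x) n"

lemma root_of_unity_odd_power_neq_minus_one:
  fixes \<zeta> :: "'a :: field_char_0"
  assumes "\<zeta> ^ (p ^ s) = 1" and "odd p"
  shows "\<zeta> ^ d \<noteq> - 1"
proof
  assume "\<zeta> ^ d = - 1"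
  hence "(\<zeta> ^ d) ^ (p ^ s) = - 1"
    using assms(2) by simp
  moreover have "(\<zeta> ^ d) ^ (p ^ s) = 1"
    by (metis assms(1) mult.commute power_mult power_one)
  ultimately show False
    by simp
qed

lemma twisted_euler_polynomial:
  fixes \<zeta> :: "'a :: field_char_0"
  assumes "\<zeta> ^ d \<noteq> - 1"
  shows "\<exists>P. \<forall>x. twisted_euler n d chi \<zeta> x = poly P x"
proof -
  define D where "D = fps_const (\<zeta> ^ d) * fps_exp (of_nat d) + 1"
  define G where "G = 2 * inverse D *
     (\<Sum>a<d. fps_const ((- 1) ^ a * chi (int a) * \<zeta> ^ a) * fps_exp (of_nat a))"
  have "fps_nth D 0 \<noteq> 0"
    using assms by (simp add: D_def add_eq_0_iff2)
  hence gf: "twisted_euler_gf d chi \<zeta> x = fps_exp x * G" for x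
    unfolding twisted_euler_gf_def G_def D_def[symmetric]
    by (simp add: fps_divide_unit mult_ac)
  have "twisted_euler n d chi \<zeta> x =
      poly (smult (fact n) (\<Sum>i=0..n. monom (fps_nth G i / fact (n - i)) (n - i))) x" for x
    by (simp add: twisted_euler_def gf fps_mult_nth poly_sum poly_monom mult_ac)
  thus ?thesis
    by blast
qed

end

theory Submission
  imports Defs "HOL-Number_Theory.Residues"
begin

text \<open>
  Put $u_k = \xi^k e^{kt}$ and $S(u) = \sum_{a<d} (-1)^a \chi(a) u^a$. Since $d$ and $w$ are odd and
  $\chi$ has period $d$, extending the sum $S(u)$ to $a < wd$ multiplies it by
  $(1 + u^{dw}) / (1 + u^d)$. Hence the exponential generating function of each of the three
  expressions is
  \[ 2 e^{w_1 w_2 w_3 y_1 t} (1 + u_{w_1 w_2 w_3}^d)^2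
     \prod_{k \in \{w_2 w_3, w_1 w_3, w_1 w_2\}} \frac{S(u_k)}{1 + u_k^d}, \]
  which is symmetric in the $w_i$.
\<close>

definition twisted_exp :: "'a \<Rightarrow> nat \<Rightarrow> 'a :: field_char_0 fps" where
  "twisted_exp \<xi> k = fps_const (\<xi> ^ k) * fps_exp (of_nat k)"

definition alternating_sum :: "nat \<Rightarrow> (int \<Rightarrow> 'a) \<Rightarrow> 'a fps \<Rightarrow> 'a :: field_char_0 fps" where
  "alternating_sum m chi u = (\<Sum>a<m. fps_const ((- 1) ^ a * chi (int a)) * u ^ a)"

text \<open>With u = \<open>twisted_exp \<xi> k\<close>, twice this series is the generating
  function of the twisted Euler polynomials for \<open>\<xi> ^ k\<close> at x = 0, after t is
  replaced by kt. The \<open>inverse\<close> is a genuine one when the constant coefficient of 1 +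
  u^d is nonzero.\<close>

definition euler_factor :: "nat \<Rightarrow> (int \<Rightarrow> 'a) \<Rightarrow> 'a fps \<Rightarrow> 'a :: field_char_0 fps" where
  "euler_factor d chi u = alternating_sum d chi u * inverse (1 + u ^ d)"

text \<open>The square collects one factor from each of the two extended character sums; the
  \<open>2\<close> and the third Euler factor come from the Euler polynomial.\<close>

definition symmetric_gf ::
    "nat \<Rightarrow> (int \<Rightarrow> 'a) \<Rightarrow> 'a \<Rightarrow> 'a \<Rightarrow> nat \<Rightarrow> nat \<Rightarrow> nat \<Rightarrow> 'a :: field_char_0 fps" where
  "symmetric_gf d chi \<xi> y w1 w2 w3 =
     2 * fps_exp (of_nat (w1 * w2 * w3) * y) * (1 + twisted_exp \<xi> (w1 * w2 * w3) ^ d) ^ 2 *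
     (euler_factor d chi (twisted_exp \<xi> (w2 * w3)) *
      euler_factor d chi (twisted_exp \<xi> (w1 * w3)) *
      euler_factor d chi (twisted_exp \<xi> (w1 * w2)))"

lemma symmetric_gf_rotate:
  "symmetric_gf d chi \<xi> y w2 w3 w1 = symmetric_gf d chi \<xi> y w1 w2 w3"
  by (simp add: symmetric_gf_def mult_ac)

lemma twisted_exp_power: "twisted_exp \<xi> k ^ m = twisted_exp \<xi> (k * m)"
  by (simp add: twisted_exp_def power_mult_distrib fps_const_power fps_exp_power_mult
      power_mult mult.commute)

lemma twisted_exp_nth_0 [simp]: "fps_nth (twisted_exp \<xi> k) 0 = \<xi> ^ k"
  by (simp add: twisted_exp_def)

lemma periodic_shift:
  assumes "\<And>a. chi (a + int d) = chi a"
  shows "chi (a + int k * int d) = chi a"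
proof (induction k)
  case (Suc k)
  have "chi (a + int (Suc k) * int d) = chi (a + int k * int d + int d)"
    by (simp add: algebra_simps)
  with Suc show ?case by (simp only: assms)
qed simp

text \<open>The range splits into w blocks of length d, and each block is -u^d times the previous
  one, so this is a finite geometric series. Multiplying through by 1 + u^d avoids any invertibility
  condition on u.\<close>

lemma alternating_sum_extend:
  assumes "\<And>a. chi (a + int d) = chi a" and "odd d"
  shows "(1 + u ^ d) * alternating_sum (w * d) chi u =
    (1 - (- (u ^ d)) ^ w) * alternating_sum d chi u"
proof (induction w)
  case 0
  show ?case by (simp add: alternating_sum_def)
next
  case (Suc w)
  have per: "chi (int (w * d + a)) = chi (int a)" for w a
    using periodic_shift[of chi d "int a" w, OF assms(1)] by (simp add: add.commute)
  have "alternating_sum (Suc w * d) chi u = alternating_sum (w * d) chi u +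
      (\<Sum>a<d. fps_const ((- 1) ^ (w * d + a) * chi (int (w * d + a))) * u ^ (w * d + a))"
    unfolding alternating_sum_def
    by (simp add: lessThan_atLeast0 add.commute
        sum.atLeastLessThan_concat[of 0 "w * d" "d + w * d", symmetric]
        sum.shift_bounds_nat_ivl[of _ 0 "w * d" d, simplified])
  also have "(\<Sum>a<d. fps_const ((- 1) ^ (w * d + a) * chi (int (w * d + a))) * u ^ (w * d + a)) =
      (- (u ^ d)) ^ w * alternating_sum d chi u"
  proof -
    \<comment> \<open>For odd d, each shift by d changes the sign once.\<close>
    have sgn: "(- 1 :: 'a) ^ (w * d + a) = (- 1) ^ w * (- 1) ^ a" for a
      using assms(2) by (simp add: power_add minus_one_power_iff)
    have "(- (u ^ d)) ^ w = fps_const ((- 1) ^ w) * u ^ (w * d)"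
      by (metis (no_types) fps_const_1_eq_1 fps_const_neg fps_const_power mult.commute
          power_minus power_mult)
    thus ?thesis
      unfolding alternating_sum_def per sgn sum_distrib_left
      by (intro sum.cong) (simp_all add: power_add mult_ac flip: fps_const_mult)
  qed
  finally have "(1 + u ^ d) * alternating_sum (Suc w * d) chi u =
      (1 + u ^ d) * alternating_sum (w * d) chi u +
      (1 + u ^ d) * ((- (u ^ d)) ^ w * alternating_sum d chi u)"
    by (simp add: distrib_left)
  also have "\<dots> = (1 - (- (u ^ d)) ^ Suc w) * alternating_sum d chi u"
    unfolding Suc by (simp add: algebra_simps)
  finally show ?case .
qed

text \<open>For odd w the geometric factor 1 - (-u^d)^w becomes 1 + u^(dw), and the condition on the
  constant coefficient allows division by 1 + u^d.\<close>

lemma alternating_sum_eq_euler_factor: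
  assumes "\<And>a. chi (a + int d) = chi a" and "odd d" and "odd w"
    and "fps_nth u 0 ^ d \<noteq> - 1"
  shows "alternating_sum (w * d) chi u = (1 + (u ^ w) ^ d) * euler_factor d chi u"
proof -
  have unit: "inverse (1 + u ^ d) * (1 + u ^ d) = 1"
    using assms(4) by (intro inverse_mult_eq_1) (simp add: fps_power_zeroth add_eq_0_iff)
  have "alternating_sum (w * d) chi u =
      inverse (1 + u ^ d) * ((1 + u ^ d) * alternating_sum (w * d) chi u)"
    using unit by (simp flip: mult.assoc)
  also have "\<dots> = inverse (1 + u ^ d) * ((1 + (u ^ w) ^ d) * alternating_sum d chi u)"
    unfolding alternating_sum_extend[of chi, OF assms(1,2)]
    using assms(3) by (simp add: power_minus_odd mult.commute flip: power_mult)
  finally show ?thesis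
    by (simp add: euler_factor_def mult_ac)
qed

text \<open>Substituting kt for t multiplies the n-th coefficient by k^n and turns \<xi>^k e^t into
  \<open>twisted_exp \<xi> k\<close>. This is where the powers in front of the double sums are
  absorbed.\<close>

lemma twisted_euler_scaled:
  assumes "\<xi> ^ (k * d) \<noteq> - 1"
  shows "of_nat k ^ n * twisted_euler n d chi (\<xi> ^ k) x =
    fact n * fps_nth (2 * fps_exp (of_nat k * x) * euler_factor d chi (twisted_exp \<xi> k)) n"
proof -
  define L where "L = fps_const (of_nat k :: 'a) * fps_X"
  have L0: "fps_nth L 0 = 0"
    by (simp add: L_def)
  define D where "D = fps_const ((\<xi> ^ k) ^ d) * fps_exp (of_nat d) + 1"
  \<comment> \<open>A nonzero constant term makes the quotient a product with an inverse, and
    inversion commutes with composition by L.\<close>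
  have D0: "fps_nth D 0 \<noteq> 0"
    using assms by (simp add: D_def add_eq_0_iff2 flip: power_mult)
  have exp: "fps_exp c oo L = fps_exp (of_nat k * c)" for c
    unfolding L_def fps_exp_compose_linear by (simp only: mult.commute)
  have tw: "fps_const ((\<xi> ^ k) ^ m) * fps_exp (of_nat k * of_nat m) = twisted_exp \<xi> k ^ m" for m
    unfolding twisted_exp_power by (simp add: twisted_exp_def power_mult)
  have DL: "D oo L = 1 + twisted_exp \<xi> k ^ d"
    by (simp add: D_def fps_compose_add_distrib fps_compose_mult_distrib[OF L0] exp tw)
  have SL: "(\<Sum>a<d. fps_const ((- 1) ^ a * chi (int a) * (\<xi> ^ k) ^ a) * fps_exp (of_nat a)) oo L =
      alternating_sum d chi (twisted_exp \<xi> k)"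
    by (simp add: alternating_sum_def fps_compose_sum_distrib fps_compose_mult_distrib[OF L0]
        exp mult.assoc flip: tw fps_const_mult)
  have "twisted_euler_gf d chi (\<xi> ^ k) x oo L =
      2 * fps_exp (of_nat k * x) * euler_factor d chi (twisted_exp \<xi> k)"
    unfolding twisted_euler_gf_def D_def[symmetric] fps_divide_unit[OF D0]
      fps_compose_mult_distrib[OF L0] SL fps_inverse_compose[OF L0 D0] DL exp euler_factor_def
    by (simp add: mult_ac numeral_fps_const)
  moreover have "of_nat k ^ n * fps_nth (twisted_euler_gf d chi (\<xi> ^ k) x) n =
      fps_nth (twisted_euler_gf d chi (\<xi> ^ k) x oo L) n"
    by (simp add: L_def fps_compose_linear)
  ultimately show ?thesis
    by (simp add: twisted_euler_def mult_ac)
qed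

text \<open>Scaling by k = w1 w2 clears the denominators in the argument, so the exponential splits
  into a factor in a and a factor in b. As chi is multiplicative, the double sum becomes a product
  of two alternating sums.\<close>

lemma double_twisted_euler_sum:
  fixes \<xi> y :: "'a :: field_char_0"
  assumes "\<And>a. chi (a + int d) = chi a" and "\<And>a b. chi (a * b) = chi a * chi b"
    and "odd d" and "odd w1" and "odd w2"
    and neq: "\<And>k. \<xi> ^ k \<noteq> - 1"
  shows "of_nat (w1 * w2) ^ n *
       (\<Sum>a<w1 * d. \<Sum>b<w2 * d. (- 1) ^ (a + b) * chi (int (a * b)) * \<xi> ^ (w3 * (a * w2 + b * w1)) *
          twisted_euler n d chi (\<xi> ^ (w1 * w2))
            (of_nat w3 * y + of_nat w3 / of_nat w1 * of_nat a + of_nat w3 / of_nat w2 * of_nat b))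
     = fact n * fps_nth (symmetric_gf d chi \<xi> y w1 w2 w3) n" (is "?lhs = _")
proof -
  define E where "E = euler_factor d chi (twisted_exp \<xi> (w1 * w2))"
  define Y where "Y = of_nat (w1 * w2 * w3) * y"
  let ?A = "\<lambda>a. fps_const ((- 1) ^ a * chi (int a)) * twisted_exp \<xi> (w2 * w3) ^ a"
  let ?B = "\<lambda>b. fps_const ((- 1) ^ b * chi (int b)) * twisted_exp \<xi> (w1 * w3) ^ b"
  have w: "of_nat w1 \<noteq> (0 :: 'a)" "of_nat w2 \<noteq> (0 :: 'a)"
    using assms(4,5) by (auto intro: odd_pos)
  have summand: "of_nat (w1 * w2) ^ n * ((- 1) ^ (a + b) * chi (int (a * b)) *
        \<xi> ^ (w3 * (a * w2 + b * w1)) * twisted_euler n d chi (\<xi> ^ (w1 * w2))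
          (of_nat w3 * y + of_nat w3 / of_nat w1 * of_nat a + of_nat w3 / of_nat w2 * of_nat b)) =
      fact n * fps_nth (?A a * ?B b * (2 * fps_exp Y * E)) n"
    (is "_ * (?c * twisted_euler _ _ _ _ ?x) = _")
    for a b
  proof -
    have "of_nat (w1 * w2) * ?x = Y + (of_nat (w2 * w3 * a) + of_nat (w1 * w3 * b))"
      using w by (simp add: Y_def field_simps)
    hence exp: "fps_exp (of_nat (w1 * w2) * ?x) =
        fps_exp Y * (fps_exp (of_nat (w2 * w3 * a)) * fps_exp (of_nat (w1 * w3 * b)))"
      by (simp only: fps_exp_add_mult)
    have c: "?c = ((- 1) ^ a * chi (int a)) * ((- 1) ^ b * chi (int b)) *
        (\<xi> ^ (w2 * w3 * a) * \<xi> ^ (w1 * w3 * b))"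
      by (simp add: power_add assms(2) algebra_simps flip: power_mult)
    have gf: "?A a * ?B b * (2 * fps_exp Y * E) =
        fps_const ?c * (2 * fps_exp (of_nat (w1 * w2) * ?x) * E)"
      unfolding exp c twisted_exp_power
      unfolding twisted_exp_def fps_const_mult[symmetric]
      by (simp only: mult_ac)
    show ?thesis
      unfolding mult.left_commute[of _ ?c] twisted_euler_scaled[OF neq] gf E_def[symmetric]
      by (simp only: fps_mult_left_const_nth mult.left_commute)
  qed
  have "?lhs = fact n * fps_nth (\<Sum>a<w1 * d. \<Sum>b<w2 * d. ?A a * ?B b * (2 * fps_exp Y * E)) n"
    by (simp only: sum_distrib_left summand fps_sum_nth)
  also have "(\<Sum>a<w1 * d. \<Sum>b<w2 * d. ?A a * ?B b * (2 * fps_exp Y * E)) =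
      alternating_sum (w1 * d) chi (twisted_exp \<xi> (w2 * w3)) *
      alternating_sum (w2 * d) chi (twisted_exp \<xi> (w1 * w3)) * (2 * fps_exp Y * E)"
    unfolding alternating_sum_def sum_product by (simp only: sum_distrib_right)
  also have "\<dots> = symmetric_gf d chi \<xi> y w1 w2 w3"
  proof -
    have "fps_nth (twisted_exp \<xi> k) 0 ^ d \<noteq> - 1" for k
      using neq[of "k * d"] by (simp add: power_mult)
    note ext = alternating_sum_eq_euler_factor[of chi, OF assms(1,3) _ this]
    \<comment> \<open>Each index is a product of two weights; raising to the power of the missing
      one gives the same series in both cases, hence the square in
      \<open>symmetric_gf\<close>.\<close>
    have Q: "twisted_exp \<xi> (w2 * w3) ^ w1 = twisted_exp \<xi> (w1 * w2 * w3)"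
      "twisted_exp \<xi> (w1 * w3) ^ w2 = twisted_exp \<xi> (w1 * w2 * w3)"
      unfolding twisted_exp_power by (simp_all only: mult_ac)
    show ?thesis
      unfolding ext[OF assms(4)] ext[OF assms(5)] Q symmetric_gf_def E_def Y_def power2_eq_square
      by (simp only: mult_ac)
  qed
  finally show ?thesis .
qed

text \<open>By Euler's theorem every nonzero value is a root of unity. Algebraicity matters because
  an embedding is only assumed to respect products of algebraic numbers.\<close>

lemma dirichlet_character_algebraic:
  fixes chi :: "int \<Rightarrow> complex"
  assumes "dirichlet_character d chi"
  shows "algebraic (chi a)"
proof (cases "coprime a (int d)")
  case False
  hence "chi a = 0"
    using assms by (auto simp: dirichlet_character_def)
  thus ?thesis by simp
next
  case True
  have d: "d > 0" and per: "\<And>a. chi (a + int d) = chi a"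
    and mult: "\<And>a b. chi (a * b) = chi a * chi b" and "chi 1 \<noteq> 0"
    using assms by (auto simp: dirichlet_character_def)
  have one: "chi 1 = 1"
    using mult[of 1 1] \<open>chi 1 \<noteq> 0\<close> by simp
  have pow: "chi (a ^ k) = chi a ^ k" for k
    by (induction k) (simp_all add: one mult)
  have shift: "chi (x + int k * int d) = chi x" for x k
    using per by (rule periodic_shift)
  have cong: "chi x = chi (x mod int d)" for x
  proof (cases "x div int d \<ge> 0")
    case True
    thus ?thesis
      using shift[of "x mod int d" "nat (x div int d)"] by simp
  next
    case False
    thus ?thesis
      \<comment> \<open>For a negative quotient the shift goes upwards, from x to its
        residue.\<close>
      using shift[of x "nat (- (x div int d))"] by (simp add: minus_div_mult_eq_mod)
  qed
  define k where "k = totient d"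
  have "k > 0"
    using d by (simp add: k_def)
  \<comment> \<open>A natural representative of a, to which Euler's theorem applies.\<close>
  define b where "b = nat (a mod int d)"
  have b: "int b = a mod int d"
    using d by (simp add: b_def)
  have "coprime (int b) (int d)"
    using True d by (simp add: b coprime_mod_left_iff)
  hence "[b ^ k = 1] (mod d)"
    unfolding k_def by (intro euler_theorem) simp
  hence "[int b ^ k = 1] (mod int d)"
    by (metis cong_int_iff of_nat_1 of_nat_power)
  hence "[a ^ k = 1] (mod int d)"
    by (simp add: b cong_def power_mod)
  hence "chi (a ^ k) = chi 1"
    using cong[of "a ^ k"] cong[of 1] by (simp add: cong_def)
  hence root: "chi a ^ k = 1"
    by (simp add: pow one)
  show ?thesis
  proof (rule algebraicI)
    show "Polynomial.monom (1 :: complex) k - 1 \<noteq> 0"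
    proof
      assume "Polynomial.monom (1 :: complex) k - 1 = 0"
      hence "Polynomial.coeff (Polynomial.monom (1 :: complex) k - 1) k = 0" by simp
      thus False using \<open>k > 0\<close> by simp
    qed
  qed (auto simp: root poly_monom)
qed

theorem theorem6:
  fixes nrm :: "'a :: field_char_0 \<Rightarrow> real"
    and p s d n w1 w2 w3 :: nat
    and \<xi> y1 :: 'a
    and \<iota> :: "complex \<Rightarrow> 'a"
    and chi0 :: "int \<Rightarrow> complex"
    and chi :: "int \<Rightarrow> 'a"
  assumes "complex_padic_field nrm p" and "odd p"
    and "s > 0" and "\<xi> ^ (p ^ s) = 1"
    and "d > 0" and "odd d"
    and "algebraic_numbers_embedding \<iota>"
    and "primitive_dirichlet_character d chi0"
    and "\<And>m. chi m = \<iota> (chi0 m)"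
    and "w1 > 0" and "odd w1"
    and "w2 > 0" and "odd w2"
    and "w3 > 0" and "odd w3"
    and "y1 \<in> ultrametric_field.Zp nrm"
  shows
    "of_nat (w1 * w2) ^ n *
       (\<Sum>a<w1 * d. \<Sum>b<w2 * d. (- 1) ^ (a + b) * chi (int (a * b)) * \<xi> ^ (w3 * (a * w2 + b * w1)) *
          twisted_euler n d chi (\<xi> ^ (w1 * w2))
            (of_nat w3 * y1 + of_nat w3 / of_nat w1 * of_nat a + of_nat w3 / of_nat w2 * of_nat b))
     = of_nat (w2 * w3) ^ n *
       (\<Sum>a<w2 * d. \<Sum>b<w3 * d. (- 1) ^ (a + b) * chi (int (a * b)) * \<xi> ^ (w1 * (a * w3 + b * w2)) *
          twisted_euler n d chi (\<xi> ^ (w2 * w3))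
            (of_nat w1 * y1 + of_nat w1 / of_nat w2 * of_nat a + of_nat w1 / of_nat w3 * of_nat b))
     \<and>
     of_nat (w2 * w3) ^ n *
       (\<Sum>a<w2 * d. \<Sum>b<w3 * d. (- 1) ^ (a + b) * chi (int (a * b)) * \<xi> ^ (w1 * (a * w3 + b * w2)) *
          twisted_euler n d chi (\<xi> ^ (w2 * w3))
            (of_nat w1 * y1 + of_nat w1 / of_nat w2 * of_nat a + of_nat w1 / of_nat w3 * of_nat b))
     = of_nat (w3 * w1) ^ n *
       (\<Sum>a<w3 * d. \<Sum>b<w1 * d. (- 1) ^ (a + b) * chi (int (a * b)) * \<xi> ^ (w2 * (a * w1 + b * w3)) *
          twisted_euler n d chi (\<xi> ^ (w1 * w3))
            (of_nat w2 * y1 + of_nat w2 / of_nat w3 * of_nat a + of_nat w2 / of_nat w1 * of_nat b))"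
proof -
  have chi0: "dirichlet_character d chi0"
    using assms(8) by (simp add: primitive_dirichlet_character_def)
  have per: "\<And>a. chi (a + int d) = chi a"
    using chi0 by (simp add: assms(9) dirichlet_character_def)
  have mult: "\<And>a b. chi (a * b) = chi a * chi b"
    using chi0 assms(7) dirichlet_character_algebraic[OF chi0]
    by (simp add: assms(9) dirichlet_character_def algebraic_numbers_embedding_def)
  \<comment> \<open>The order of \<xi> divides a power of the odd p, so no power of \<xi> is -1 and
    all denominators are invertible.\<close>
  have neq: "\<And>k. \<xi> ^ k \<noteq> - 1"
    using root_of_unity_odd_power_neq_minus_one[OF assms(4,2)] .
  note sums = double_twisted_euler_sum[of chi, OF per mult \<open>odd d\<close> _ _ neq]
  have "symmetric_gf d chi \<xi> y1 w3 w1 w2 = symmetric_gf d chi \<xi> y1 w1 w2 w3"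
    using symmetric_gf_rotate by metis
  \<comment> \<open>The three expressions are one double sum at the cyclic rotations of (w1, w2,
    w3). The third mixes \<open>w3 * w1\<close> with \<open>w1 * w3\<close>, hence the
    commutation.\<close>
  thus ?thesis
    using sums[OF \<open>odd w1\<close> \<open>odd w2\<close>, of n w3 y1] sums[OF \<open>odd w2\<close> \<open>odd w3\<close>, of n w1 y1]
      sums[OF \<open>odd w3\<close> \<open>odd w1\<close>, of n w2 y1] symmetric_gf_rotate[of d chi \<xi> y1 w2 w3 w1]
    by (simp only: mult.commute[of w3 w1])
qed

end
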